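(* Let $q\in\mathbb{C}$ be nonzero and not a root of unity, let $\mathcal{W}_q$ be the $q$-deformed $W(2,2)$ algebra with bracket $[\cdot,\cdot]_q$, and let $\alpha:\mathcal{W}_q\to\mathcal{W}_q$ be the linear map with $$\alpha(L_n)=(q^n+q^{-n})L_n,\qquad \alpha(M_n)=(q^n+q^{-n})M_n\qquad(n\in\mathbb{Z}).$$ Then the triple $(\mathcal{W}_q,[\cdot,\cdot]_q,\alpha)$ is a Hom-Lie algebra.
   Context: All vector spaces and algebras are over $\mathbb{C}$. A Hom-Lie algebra is a triple $(\mathcal{L},[\cdot,\cdot],\alpha)$ consisting of a vector space $\mathcal{L}$, a bilinear map $[\cdot,\cdot]:\mathcal{L}\times\mathcal{L}\to\mathcal{L}$ and a linear map $\alpha:\mathcal{L}\to\mathcal{L}$ such that for all $x,y,z\in\mathcal{L}$: $[x,y]=-[y,x]$ and $[[x,y],\alpha(z)]+[[y,z],\alpha(x)]+[[z,x],\alpha(y)]=0$. The $q$-number is $[n]_q=\frac{q^n-q^{-n}}{q-q^{-1}}$. The $q$-deformed $W(2,2)$ algebra $\mathcal{W}_q$ is the vector space with basis $\{L_n,M_n: n\in\mathbb{Z}\}$ and skew-symmetric bilinear bracket $[\cdot,\cdot]_q$ given by $[L_n,L_m]_q=[m-n]_qL_{m+n}$, $[L_n,M_m]_q=[m-n]_qM_{m+n}$, $[M_n,M_m]_q=0$ for all $m,n\in\mathbb{Z}$. *)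

theory Defs
  imports Complex_Main "HOL-Library.Poly_Mapping"
begin

locale hom_lie_algebra = vector_space scale
  for scale :: "complex \<Rightarrow> 'v::ab_group_add \<Rightarrow> 'v" +
  fixes bracket :: "'v \<Rightarrow> 'v \<Rightarrow> 'v"
    and twist :: "'v \<Rightarrow> 'v"
  assumes linear_bracket_right: "Vector_Spaces.linear scale scale (\<lambda>y. bracket x y)"
    and linear_bracket_left: "Vector_Spaces.linear scale scale (\<lambda>x. bracket x y)"
    and linear_twist: "Vector_Spaces.linear scale scale twist"
    and skew_symmetric: "bracket x y = - bracket y x"
    and hom_jacobi: "bracket (bracket x y) (twist z) + bracket (bracket y z) (twist x)
                       + bracket (bracket z x) (twist y) = 0"

definition q_number :: "complex \<Rightarrow> int \<Rightarrow> complex" where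
  "q_number q n = (q powi n - q powi (- n)) / (q - inverse q)"

text \<open>The underlying space of the algebra is the free complex vector space on the symbols
  \<open>L n\<close>, \<open>M n\<close>: finitely supported functions into the complex numbers.\<close>

datatype w_index = L int | M int

type_synonym w_space = "w_index \<Rightarrow>\<^sub>0 complex"

definition w_scale :: "complex \<Rightarrow> w_space \<Rightarrow> w_space" where
  "w_scale c x = Poly_Mapping.map (\<lambda>a. c * a) x"

definition w_basis :: "w_index \<Rightarrow> w_space" where
  "w_basis i = Poly_Mapping.single i 1"

abbreviation L_vec :: "int \<Rightarrow> w_space" where "L_vec n \<equiv> w_basis (L n)"
abbreviation M_vec :: "int \<Rightarrow> w_space" where "M_vec n \<equiv> w_basis (M n)"

text \<open>The bracket on basis vectors; the third equation is forced by skew-symmetry.\<close>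

fun w_bracket_basis :: "complex \<Rightarrow> w_index \<Rightarrow> w_index \<Rightarrow> w_space" where
  "w_bracket_basis q (L n) (L m) = w_scale (q_number q (m - n)) (L_vec (m + n))"
| "w_bracket_basis q (L n) (M m) = w_scale (q_number q (m - n)) (M_vec (m + n))"
| "w_bracket_basis q (M n) (L m) = - w_scale (q_number q (n - m)) (M_vec (n + m))"
| "w_bracket_basis q (M n) (M m) = 0"

text \<open>Bilinear extension.\<close>

definition w_bracket :: "complex \<Rightarrow> w_space \<Rightarrow> w_space \<Rightarrow> w_space" where
  "w_bracket q x y =
     (\<Sum>i\<in>Poly_Mapping.keys x. \<Sum>j\<in>Poly_Mapping.keys y.
        w_scale (Poly_Mapping.lookup x i * Poly_Mapping.lookup y j) (w_bracket_basis q i j))"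

lemma lookup_w_scale [simp]: "Poly_Mapping.lookup (w_scale c x) i = c * Poly_Mapping.lookup x i"
  by (simp add: w_scale_def Poly_Mapping.map.rep_eq when_def)

lemma vector_space_w_scale: "vector_space w_scale"
  by unfold_locales (auto intro!: poly_mapping_eqI simp: lookup_add algebra_simps)

interpretation w: vector_space w_scale
  by (rule vector_space_w_scale)

lemma inj_w_basis: "inj w_basis"
  by (auto simp: inj_def w_basis_def dest: arg_cong[of _ _ Poly_Mapping.keys])

lemma w_expansion: "x = (\<Sum>i\<in>Poly_Mapping.keys x. w_scale (Poly_Mapping.lookup x i) (w_basis i))"
proof (rule poly_mapping_eqI)
  fix k
  have "(\<Sum>i\<in>Poly_Mapping.keys x. Poly_Mapping.lookup x i * (1 when i = k))
          = (\<Sum>i\<in>Poly_Mapping.keys x. if i = k then Poly_Mapping.lookup x i else 0)"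
    by (rule sum.cong) auto
  then show "Poly_Mapping.lookup x k = Poly_Mapping.lookup
      (\<Sum>i\<in>Poly_Mapping.keys x. w_scale (Poly_Mapping.lookup x i) (w_basis i)) k"
    by (auto simp: lookup_sum w_basis_def lookup_single sum.delta in_keys_iff)
qed

lemma span_w_basis: "w.span (range w_basis) = UNIV"
proof -
  have "x \<in> w.span (range w_basis)" for x
    by (subst w_expansion) (auto intro!: w.span_sum w.span_scale intro: w.span_base)
  then show ?thesis by blast
qed

lemma independent_w_basis: "\<not> w.dependent (range w_basis)"
proof
  assume "w.dependent (range w_basis)"
  then obtain t u v where t: "finite t" "t \<subseteq> range w_basis"
    and s: "(\<Sum>v\<in>t. w_scale (u v) v) = 0" and v: "v \<in> t" "u v \<noteq> 0"
    unfolding w.dependent_explicit by blast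
  from t v obtain k where k: "v = w_basis k" by blast
  have "Poly_Mapping.lookup w k = (if w = v then 1 else 0)" if "w \<in> t" for w
    using that t(2) injD[OF inj_w_basis] by (auto simp: k w_basis_def lookup_single when_def)
  then have "(\<Sum>w\<in>t. u w * Poly_Mapping.lookup w k) = (\<Sum>w\<in>t. if w = v then u w else 0)"
    by (intro sum.cong) auto
  also have "\<dots> = u v" using t(1) v(1) by simp
  finally have "Poly_Mapping.lookup (\<Sum>v\<in>t. w_scale (u v) v) k = u v"
    by (simp add: lookup_sum)
  then show False using s v(2) by simp
qed

lemma w_bracket_w_basis: "w_bracket q (w_basis i) (w_basis j) = w_bracket_basis q i j"
  by (simp add: w_bracket_def w_basis_def lookup_single)

end

theory Submission
  imports Defs
begin

text \<open>
  Skew-symmetry and bilinearity of the bracket come from its definition as the bilinear extension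
  of a skew-symmetric table of products of basis vectors. The only identity with content is the
  twisted Jacobi identity. Its left-hand side is trilinear and invariant under cyclic rotation of
  its three arguments, so it is enough to check it on basis vectors
  (\<open>cyclic_trilinear_eq_zero\<close>).

  On basis vectors of degrees \<open>n\<close>, \<open>m\<close>, \<open>p\<close>, each of the three double brackets is a multiple of one
  and the same vector: it is the basis vector of degree \<open>n + m + p\<close> (of type \<open>L\<close> if all three
  arguments are of type \<open>L\<close>, of type \<open>M\<close> if exactly one of them is of type \<open>M\<close>), or zero if at least two
  arguments are of type \<open>M\<close>. The letters \<open>L\<close> and \<open>M\<close> thus disappear, and there remains one scalar
  identity: the cyclic sum of
  \<open>[m - n]\<^sub>q [p - m - n]\<^sub>q (q\<^sup>p + q\<^sup>-\<^sup>p)\<close> is zero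
  (\<open>q_number_cyclic_identity\<close>). With \<open>a = q\<^sup>2\<^sup>n\<close>, \<open>b = q\<^sup>2\<^sup>m\<close>, \<open>c = q\<^sup>2\<^sup>p\<close> the summand is,
  up to the factor \<open>1 / (abc (q - q\<^sup>-\<^sup>1)\<^sup>2)\<close>, the polynomial \<open>(b - a)(c - ab)(c + 1)\<close>, whose
  cyclic sum is zero.
\<close>

section \<open>The identity between q-numbers\<close>

lemma q_number_minus: "q_number q (- n) = - q_number q n"
  by (simp add: q_number_def minus_divide_left)

lemma polynomial_cyclic_identity:
  fixes a b c :: "'a::comm_ring_1"
  shows "(b - a) * (c - a * b) * (c + 1) + (c - b) * (a - b * c) * (a + 1)
           + (a - c) * (b - c * a) * (b + 1) = 0"
  by (simp add: algebra_simps)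

definition jacobi_coeff :: "complex \<Rightarrow> int \<Rightarrow> int \<Rightarrow> int \<Rightarrow> complex" where
  "jacobi_coeff q n m p =
     q_number q (m - n) * q_number q (p - (m + n)) * (q powi p + q powi (- p))"

lemma jacobi_coeff_eq:
  fixes q :: complex
  assumes q: "q \<noteq> 0"
  defines "s \<equiv> \<lambda>n. (q powi n)\<^sup>2"
  shows "jacobi_coeff q n m p =
           (s m - s n) * (s p - s n * s m) * (s p + 1)
             * inverse (s n * s m * s p * (q - inverse q)\<^sup>2)"
proof -
  \<comment> \<open>The factor \<open>q - q\<^sup>-\<^sup>1\<close> stays an inverse throughout, and only powers of \<open>q\<close>, which are
    nonzero, are cleared from denominators.\<close>
  define u v w where "u = q powi n" and "v = q powi m" and "w = q powi p"
  have nz: "u \<noteq> 0" "v \<noteq> 0" "w \<noteq> 0"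
    using q by (simp_all add: u_def v_def w_def)
  have "(v / u - u / v) * (w / (v * u) - v * u / w) * (w + 1 / w) =
          (v\<^sup>2 - u\<^sup>2) * (w\<^sup>2 - u\<^sup>2 * v\<^sup>2) * (w\<^sup>2 + 1) / (u\<^sup>2 * v\<^sup>2 * w\<^sup>2)"
  proof -
    have "v / u - u / v = (v\<^sup>2 - u\<^sup>2) / (u * v)"
      using nz by (simp add: field_simps power2_eq_square)
    moreover have "w / (v * u) - v * u / w = (w\<^sup>2 - u\<^sup>2 * v\<^sup>2) / (u * v * w)"
      using nz by (simp add: field_simps power2_eq_square)
    moreover have "w + 1 / w = (w\<^sup>2 + 1) / w"
      using nz by (simp add: field_simps power2_eq_square)
    ultimately show ?thesis
      by (simp add: power2_eq_square mult_ac)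
  qed
  moreover have "jacobi_coeff q n m p =
      (v / u - u / v) * (w / (v * u) - v * u / w) * (w + 1 / w) * inverse ((q - inverse q)\<^sup>2)"
    using q by (simp add: jacobi_coeff_def q_number_def u_def v_def w_def power_int_diff
        power_int_add power_int_minus power2_eq_square divide_inverse mult_ac)
  ultimately show ?thesis
    by (simp add: s_def u_def v_def w_def divide_inverse mult_ac)
qed

lemma q_number_cyclic_identity:
  assumes "q \<noteq> 0"
  shows "jacobi_coeff q n m p + jacobi_coeff q m p n + jacobi_coeff q p n m = 0"
proof -
  define a b c where "a = (q powi n)\<^sup>2" and "b = (q powi m)\<^sup>2" and "c = (q powi p)\<^sup>2"
  have "jacobi_coeff q n m p + jacobi_coeff q m p n + jacobi_coeff q p n m =
      ((b - a) * (c - a * b) * (c + 1) + (c - b) * (a - b * c) * (a + 1)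
           + (a - c) * (b - c * a) * (b + 1)) * inverse (a * b * c * (q - inverse q)\<^sup>2)"
    unfolding jacobi_coeff_eq[OF assms] distrib_right
    by (simp add: a_def b_def c_def mult_ac)
  then show ?thesis
    by (simp only: polynomial_cyclic_identity mult_zero_left)
qed

section \<open>Bilinearity and skew-symmetry of the bracket\<close>

interpretation ww: vector_space_pair w_scale w_scale
  by unfold_locales

text \<open>Summing over sets that are larger than the supports lets brackets of different vectors be
  compared term by term.\<close>

lemma w_bracket_superset:
  assumes "finite A" "Poly_Mapping.keys x \<subseteq> A" "finite B" "Poly_Mapping.keys y \<subseteq> B"
  shows "w_bracket q x y = (\<Sum>i\<in>A. \<Sum>j\<in>B.
           w_scale (Poly_Mapping.lookup x i * Poly_Mapping.lookup y j) (w_bracket_basis q i j))"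
proof -
  have "w_bracket q x y = (\<Sum>i\<in>Poly_Mapping.keys x. \<Sum>j\<in>B.
           w_scale (Poly_Mapping.lookup x i * Poly_Mapping.lookup y j) (w_bracket_basis q i j))"
    unfolding w_bracket_def using assms
    by (intro sum.cong refl sum.mono_neutral_left) (auto simp: in_keys_iff)
  also have "\<dots> = (\<Sum>i\<in>A. \<Sum>j\<in>B.
           w_scale (Poly_Mapping.lookup x i * Poly_Mapping.lookup y j) (w_bracket_basis q i j))"
    using assms by (intro sum.mono_neutral_left) (auto simp: in_keys_iff)
  finally show ?thesis .
qed

lemma w_bracket_linear_right: "Vector_Spaces.linear w_scale w_scale (w_bracket q x)"
unfolding Vector_Spaces.linear_iff
proof (intro conjI allI vector_space_w_scale)
  fix y z :: w_space
  let ?A = "Poly_Mapping.keys x" and ?B = "Poly_Mapping.keys y \<union> Poly_Mapping.keys z"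
  show "w_bracket q x (y + z) = w_bracket q x y + w_bracket q x z"
    using keys_add[of y z]
    by (simp add: w_bracket_superset[of ?A x ?B] lookup_add distrib_left w.scale_left_distrib
        sum.distrib)
next
  fix c and y :: w_space
  have "Poly_Mapping.keys (w_scale c y) \<subseteq> Poly_Mapping.keys y"
    by (auto simp: in_keys_iff)
  then show "w_bracket q x (w_scale c y) = w_scale c (w_bracket q x y)"
    by (simp add: w_bracket_superset[of "Poly_Mapping.keys x" x "Poly_Mapping.keys y"]
        w.scale_sum_right mult_ac)
qed

lemma w_bracket_basis_skew: "w_bracket_basis q i j = - w_bracket_basis q j i"
proof (cases i; cases j)
  fix n m
  assume "i = L n" "j = L m"
  then show ?thesis
    using q_number_minus[of q "n - m"] by (simp add: add.commute)
qed (simp_all add: add.commute)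

lemma w_bracket_skew: "w_bracket q x y = - w_bracket q y x"
proof -
  have "w_bracket q x y = (\<Sum>j\<in>Poly_Mapping.keys y. \<Sum>i\<in>Poly_Mapping.keys x.
          w_scale (Poly_Mapping.lookup x i * Poly_Mapping.lookup y j) (w_bracket_basis q i j))"
    unfolding w_bracket_def by (rule sum.swap)
  also have "\<dots> = (\<Sum>j\<in>Poly_Mapping.keys y. \<Sum>i\<in>Poly_Mapping.keys x.
          - w_scale (Poly_Mapping.lookup y j * Poly_Mapping.lookup x i) (w_bracket_basis q j i))"
    by (intro sum.cong refl) (subst w_bracket_basis_skew, simp add: mult.commute)
  also have "\<dots> = - w_bracket q y x"
    by (simp add: w_bracket_def sum_negf)
  finally show ?thesis .
qed

lemma w_bracket_linear_left: "Vector_Spaces.linear w_scale w_scale (\<lambda>x. w_bracket q x y)"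
  by (subst w_bracket_skew) (intro ww.linear_compose_neg w_bracket_linear_right)

section \<open>The twisted Jacobi identity\<close>

lemma linear_eq_zero_of_basis:
  assumes "Vector_Spaces.linear w_scale w_scale f" "\<And>i. f (w_basis i) = 0"
  shows "f x = 0"
  using ww.linear_eq_0_on_span[OF assms(1), of "range w_basis" x] assms(2)
  by (auto simp: span_w_basis)

text \<open>Rotating the arguments moves each of them in turn to the last place, so linearity in that
  place allows all three to be replaced by basis vectors, one after the other.\<close>

lemma cyclic_trilinear_eq_zero:
  assumes lin: "\<And>x y. Vector_Spaces.linear w_scale w_scale (T x y)"
    and cyc: "\<And>x y z. T x y z = T y z x"
    and basis: "\<And>i j k. T (w_basis i) (w_basis j) (w_basis k) = 0"
  shows "T x y z = 0"
proof -
  have 1: "T (w_basis i) (w_basis j) z = 0" for i j z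
    by (rule linear_eq_zero_of_basis[OF lin basis])
  have 2: "T (w_basis i) y z = 0" for i y z
  proof -
    have "T z (w_basis i) y = 0"
      by (rule linear_eq_zero_of_basis[OF lin]) (simp add: cyc[of z] 1)
    then show ?thesis
      by (simp add: cyc[of z])
  qed
  have "T y z x = 0"
    by (rule linear_eq_zero_of_basis[OF lin]) (metis cyc 2)
  then show ?thesis
    by (simp add: cyc[of x])
qed

fun w_degree :: "w_index \<Rightarrow> int" where
  "w_degree (L n) = n"
| "w_degree (M n) = n"

text \<open>The vector of which all double brackets of three basis vectors are multiples: the number of letters
  \<open>M\<close> is additive under the bracket, and there is no basis vector with two of them.\<close>

fun triple_direction :: "w_index \<Rightarrow> w_index \<Rightarrow> w_index \<Rightarrow> w_space" where
  "triple_direction (L n) (L m) (L p) = L_vec (n + m + p)"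
| "triple_direction (M n) (L m) (L p) = M_vec (n + m + p)"
| "triple_direction (L n) (M m) (L p) = M_vec (n + m + p)"
| "triple_direction (L n) (L m) (M p) = M_vec (n + m + p)"
| "triple_direction _ _ _ = 0"

lemma triple_direction_rotate: "triple_direction j k i = triple_direction i j k"
  by (cases i; cases j; cases k) (simp_all add: ac_simps)

lemmas w_bracket_linear_simps =
  ww.linear_scale[OF w_bracket_linear_right] ww.linear_scale[OF w_bracket_linear_left]
  ww.linear_neg[OF w_bracket_linear_right] ww.linear_neg[OF w_bracket_linear_left]
  ww.linear_0[OF w_bracket_linear_right] ww.linear_0[OF w_bracket_linear_left]

lemma double_bracket_basis:
  assumes \<alpha>: "\<And>i. \<alpha> (w_basis i) =
                w_scale (q powi w_degree i + q powi (- w_degree i)) (w_basis i)"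
  shows "w_bracket q (w_bracket q (w_basis i) (w_basis j)) (\<alpha> (w_basis k)) =
           w_scale (jacobi_coeff q (w_degree i) (w_degree j) (w_degree k)) (triple_direction i j k)"
proof -
  \<comment> \<open>The table of products treats the order \<open>M\<close>, \<open>L\<close> by a sign; this puts it in the same form as
    the other products.\<close>
  have M_L: "w_bracket_basis q (M n) (L m) = w_scale (q_number q (m - n)) (M_vec (m + n))" for n m
    using q_number_minus[of q "m - n"] by (simp add: add.commute)
  show ?thesis
    unfolding \<alpha>
    by (cases i; cases j; cases k)
      (simp_all add: w_bracket_w_basis w_bracket_linear_simps M_L jacobi_coeff_def ac_simps
        del: w_bracket_basis.simps(3))
qed

lemma hom_jacobi_basis:
  assumes "q \<noteq> 0"
    and \<alpha>: "\<And>i. \<alpha> (w_basis i) =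
              w_scale (q powi w_degree i + q powi (- w_degree i)) (w_basis i)"
  shows "w_bracket q (w_bracket q (w_basis i) (w_basis j)) (\<alpha> (w_basis k))
           + w_bracket q (w_bracket q (w_basis j) (w_basis k)) (\<alpha> (w_basis i))
           + w_bracket q (w_bracket q (w_basis k) (w_basis i)) (\<alpha> (w_basis j)) = 0"
proof -
  have "triple_direction j k i = triple_direction i j k"
    "triple_direction k i j = triple_direction i j k"
    by (metis triple_direction_rotate)+
  then show ?thesis
    by (simp only: double_bracket_basis[OF \<alpha>] w.scale_left_distrib[symmetric]
        q_number_cyclic_identity[OF assms(1)] w.scale_zero_left)
qed

theorem theorem2p4:
  fixes q :: complex and \<alpha> :: "w_space \<Rightarrow> w_space"
  assumes "q \<noteq> 0"
    and "\<forall>k::nat. k > 0 \<longrightarrow> q ^ k \<noteq> 1"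
    and "Vector_Spaces.linear w_scale w_scale \<alpha>"
    and "\<And>n. \<alpha> (L_vec n) = w_scale (q powi n + q powi (- n)) (L_vec n)"
    and "\<And>n. \<alpha> (M_vec n) = w_scale (q powi n + q powi (- n)) (M_vec n)"
  shows "hom_lie_algebra w_scale (w_bracket q) \<alpha>"
proof
  fix x y z
  have \<alpha>: "\<alpha> (w_basis i) = w_scale (q powi w_degree i + q powi (- w_degree i)) (w_basis i)" for i
    by (cases i) (simp_all add: assms(4,5))
  define T where "T x y z = w_bracket q (w_bracket q x y) (\<alpha> z)
      + w_bracket q (w_bracket q y z) (\<alpha> x) + w_bracket q (w_bracket q z x) (\<alpha> y)" for x y z
  have "T x y z = 0"
  proof (rule cyclic_trilinear_eq_zero[where T = T])
    fix x y
    have "Vector_Spaces.linear w_scale w_scale (\<lambda>z. w_bracket q (w_bracket q x y) (\<alpha> z))"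
      using Vector_Spaces.linear_compose[OF assms(3) w_bracket_linear_right]
      by (simp add: o_def)
    moreover have "Vector_Spaces.linear w_scale w_scale (\<lambda>z. w_bracket q (w_bracket q y z) (\<alpha> x))"
      using Vector_Spaces.linear_compose[OF w_bracket_linear_right w_bracket_linear_left]
      by (simp add: o_def)
    moreover have "Vector_Spaces.linear w_scale w_scale (\<lambda>z. w_bracket q (w_bracket q z x) (\<alpha> y))"
      using Vector_Spaces.linear_compose[OF w_bracket_linear_left w_bracket_linear_left]
      by (simp add: o_def)
    ultimately show "Vector_Spaces.linear w_scale w_scale (T x y)"
      unfolding T_def by (intro ww.linear_compose_add)
  next
    show "T x y z = T y z x" for x y z
      by (simp add: T_def add_ac)
  next
    show "T (w_basis i) (w_basis j) (w_basis k) = 0" for i j k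
      unfolding T_def by (rule hom_jacobi_basis[OF assms(1) \<alpha>])
  qed
  then show "w_bracket q (w_bracket q x y) (\<alpha> z) + w_bracket q (w_bracket q y z) (\<alpha> x)
      + w_bracket q (w_bracket q z x) (\<alpha> y) = 0"
    by (simp add: T_def)
next
  show "w_bracket q x y = - w_bracket q y x" for x y
    by (rule w_bracket_skew)
qed (use ww.linear_add[OF w_bracket_linear_right] ww.linear_add[OF w_bracket_linear_left]
    ww.linear_add[OF assms(3)] ww.linear_scale[OF assms(3)] w_bracket_linear_simps in auto)

end
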